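(* $\epsilon_{\mathrm{LINE}}\leq \dfrac{\log 3}{\log 7}$.
   Context: Let $\mathbf{v}\in\mathbb{R}^3$ be a nonzero direction and let $\mathcal{L}$ be a finite set of pairwise skew lines in $\mathbb{R}^3$, in general position with respect to $\mathbf{v}$: no line is parallel to $\mathbf{v}$, and the projections of any two distinct lines of $\mathcal{L}$ along $\mathbf{v}$ onto the plane $\mathbf{v}^{\perp}$ are not parallel (so they cross in exactly one point). For distinct $\ell_1,\ell_2\in\mathcal{L}$, let $p\in\mathbf{v}^\perp$ be the crossing point of their projections; there are unique reals $z_1,z_2$ with $p+z_i\mathbf{v}\in\ell_i$, and $z_1\ne z_2$ since the lines are skew. Say that $\ell_1$ crosses over $\ell_2$ if $z_1>z_2$. This relation is a tournament on $\mathcal{L}$. A subset of $\mathcal{L}$ is called stacked (with respect to $\mathbf{v}$) if it is linearly ordered by the crossing-over relation, i.e. it induces a transitive subtournament. $\epsilon_{\mathrm{LINE}}$ denotes the best exponent for stacked subsets: the supremum of all real $\epsilon\ge 0$ for which there is a constant $c>0$ such that, for every $n\geq 1$, every $\mathbf{v}$ and every such configuration $\mathcal{L}$ of $n$ lines, $\mathcal{L}$ contains a stacked subset of size at least $c\,n^{\epsilon}$. *)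

theory Defs
  imports "HOL-Analysis.Analysis"
begin

definition is_line :: "(real^3) set \<Rightarrow> bool" where
  "is_line l \<longleftrightarrow> affine l \<and> aff_dim l = 1"

definition skew :: "(real^3) set \<Rightarrow> (real^3) set \<Rightarrow> bool" where
  "skew l l' \<longleftrightarrow> \<not> affine_parallel l l' \<and> l \<inter> l' = {}"

(* Orthogonal projection onto the plane through the origin perpendicular to v (v nonzero). *)
definition proj_along :: "real^3 \<Rightarrow> real^3 \<Rightarrow> real^3" where
  "proj_along v x = x - ((x \<bullet> v) / (v \<bullet> v)) *\<^sub>R v"

(* affine_parallel is reflexive, so the last conjunct also excludes distinct lines
   with the same projection. *)
definition line_config :: "real^3 \<Rightarrow> (real^3) set set \<Rightarrow> bool" where
  "line_config v \<L> \<longleftrightarrow>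
     v \<noteq> 0 \<and> finite \<L> \<and>
     (\<forall>l\<in>\<L>. is_line l) \<and>
     (\<forall>l\<in>\<L>. \<forall>l'\<in>\<L>. l \<noteq> l' \<longrightarrow> skew l l') \<and>
     (\<forall>l\<in>\<L>. \<not> affine_parallel l (span {v})) \<and>
     (\<forall>l\<in>\<L>. \<forall>l'\<in>\<L>. l \<noteq> l' \<longrightarrow>
        \<not> affine_parallel (proj_along v ` l) (proj_along v ` l'))"

(* In a line_config, p, z and z' are uniquely determined by two distinct lines l and l'. *)
definition crosses_over :: "real^3 \<Rightarrow> (real^3) set \<Rightarrow> (real^3) set \<Rightarrow> bool" where
  "crosses_over v l l' \<longleftrightarrow>
     (\<exists>p z z'. p \<in> proj_along v ` l \<inter> proj_along v ` l' \<and>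
        p + z *\<^sub>R v \<in> l \<and> p + z' *\<^sub>R v \<in> l' \<and> z > z')"

definition stacked :: "real^3 \<Rightarrow> (real^3) set set \<Rightarrow> bool" where
  "stacked v S \<longleftrightarrow>
     strict_linear_order_on S {(l, l'). l \<in> S \<and> l' \<in> S \<and> crosses_over v l l'}"

definition stacked_exponents :: "real set" where
  "stacked_exponents = {\<epsilon>. \<epsilon> \<ge> 0 \<and>
     (\<exists>c>0. \<forall>n\<ge>1. \<forall>v \<L>. line_config v \<L> \<and> card \<L> = n \<longrightarrow>
        (\<exists>S\<subseteq>\<L>. stacked v S \<and> real (card S) \<ge> c * real n powr \<epsilon>))}"

(* The set is nonempty (it contains 0) and bounded above (by 1), so Sup is its least upper bound. *)
definition eps_LINE :: real where
  "eps_LINE = Sup stacked_exponents"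

end

theory Submission
  imports Defs
begin

text \<open>
  The line \<open>{(t, a t + b, c t + d)}\<close>, viewed along the third axis, crosses over
  the line with parameters \<open>a', b', c', d'\<close> iff \<open>orient (a, b, c, d) = (d a - c b) a\<close> is
  positive at the difference of the two parameter vectors. As \<open>orient\<close> is homogeneous of odd degree,
  shrinking a configuration does not change its tournament; as it is continuous, replacing every
  line of one configuration by a sufficiently small copy of another one realizes the lexicographic
  product of the two tournaments. The sizes of the largest transitive subtournaments multiply.
  Seven explicit lines realize the Paley tournament on seven vertices, in which no four vertices
  are transitive, so its \<open>k\<close>-th power has \<open>7^k\<close> lines and stacked subsets of size at most \<open>3^k\<close>.
\<close>

section \<open>Sign tournaments and their lexicographic products\<close>

text \<open>For odd \<open>\<phi>\<close> the relation \<open>\<phi> (x - y) > 0\<close> is a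
  tournament on \<open>Q\<close>, so transitivity alone expresses that a subset is linearly ordered.
  The number \<open>m\<close> is only an upper bound, which is what products have to
  preserve.\<close>

definition realizes :: "('a::real_normed_vector \<Rightarrow> real) \<Rightarrow> nat \<Rightarrow> nat \<Rightarrow> bool" where
  "realizes \<phi> n m \<longleftrightarrow> (\<exists>Q. finite Q \<and> card Q = n \<and>
     (\<forall>x\<in>Q. \<forall>y\<in>Q. x \<noteq> y \<longrightarrow> \<phi> (x - y) \<noteq> 0) \<and>
     (\<forall>S\<subseteq>Q. transp_on S (\<lambda>x y. \<phi> (x - y) > 0) \<longrightarrow> card S \<le> m))"

lemma realizes_1: "realizes \<phi> 1 1"
proof -
  have "card S \<le> 1" if "S \<subseteq> {0::'a}" for S
    using card_mono[OF _ that] by simp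
  then show ?thesis
    unfolding realizes_def by (intro exI[of _ "{0}"]) auto
qed

text \<open>Continuity preserves the sign near each nonzero value, and finitely many pairs
  \<open>(w, u)\<close> admit one common scale \<open>e\<close>. A positive product records that two
  signs agree without a case distinction.\<close>

lemma small_perturbation_same_sign:
  fixes \<phi> :: "'a::real_normed_vector \<Rightarrow> real"
  assumes cont: "continuous_on UNIV \<phi>" and "finite W" "finite U" and nz: "\<And>w. w \<in> W \<Longrightarrow> \<phi> w \<noteq> 0"
  obtains e where "e > 0" "\<And>w u. w \<in> W \<Longrightarrow> u \<in> U \<Longrightarrow> \<phi> w * \<phi> (w + e *\<^sub>R u) > 0"
proof -
  have "\<forall>\<^sub>F e in at_right 0. \<phi> w * \<phi> (w + e *\<^sub>R u) > 0" if "w \<in> W" for w u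
  proof -
    have "((\<lambda>e. w + e *\<^sub>R u) \<longlongrightarrow> w + 0 *\<^sub>R u) (at_right 0)"
      by (intro tendsto_intros)
    moreover have "isCont \<phi> (w + 0 *\<^sub>R u)"
      using cont by (simp add: continuous_on_eq_continuous_at)
    ultimately have "((\<lambda>e. \<phi> w * \<phi> (w + e *\<^sub>R u)) \<longlongrightarrow> \<phi> w * \<phi> (w + 0 *\<^sub>R u)) (at_right 0)"
      by (intro tendsto_intros isCont_tendsto_compose[of _ \<phi>])
    moreover have "\<phi> w * \<phi> (w + 0 *\<^sub>R u) > 0"
      using nz[OF that] by (auto simp: zero_less_mult_iff)
    ultimately show ?thesis by (rule order_tendstoD)
  qed
  then have "\<forall>\<^sub>F e in at_right 0. \<forall>w\<in>W. \<forall>u\<in>U. \<phi> w * \<phi> (w + e *\<^sub>R u) > 0"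
    using assms by (intro eventually_ball_finite ballI) auto
  then have "\<forall>\<^sub>F e::real in at_right 0. e > 0 \<and> (\<forall>w\<in>W. \<forall>u\<in>U. \<phi> w * \<phi> (w + e *\<^sub>R u) > 0)"
    using eventually_at_right_less[of "0::real"] by eventually_elim auto
  then obtain e where "e > 0" "\<forall>w\<in>W. \<forall>u\<in>U. \<phi> w * \<phi> (w + e *\<^sub>R u) > 0"
    using eventually_happens'[OF trivial_limit_at_right_real] by blast
  then show ?thesis using that by blast
qed

text \<open>A transitive subset of the product meets at most \<open>m\<close> of the small copies,
  since representatives of the copies compare like the base points, and it meets each copy in at
  most \<open>m'\<close> points.\<close>

lemma realizes_mult:
  fixes \<phi> :: "'a::real_normed_vector \<Rightarrow> real"
  assumes cont: "continuous_on UNIV \<phi>" and hom: "\<And>r x. \<phi> (r *\<^sub>R x) = r ^ 3 * \<phi> x"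
    and "realizes \<phi> n m" "realizes \<phi> n' m'"
  shows "realizes \<phi> (n * n') (m * m')"
proof -
  obtain B where B: "finite B" "card B = n" "\<And>x y. x \<in> B \<Longrightarrow> y \<in> B \<Longrightarrow> x \<noteq> y \<Longrightarrow> \<phi> (x - y) \<noteq> 0"
    "\<And>S. S \<subseteq> B \<Longrightarrow> transp_on S (\<lambda>x y. \<phi> (x - y) > 0) \<Longrightarrow> card S \<le> m"
    using assms(3) unfolding realizes_def by blast
  obtain Q where Q: "finite Q" "card Q = n'" "\<And>x y. x \<in> Q \<Longrightarrow> y \<in> Q \<Longrightarrow> x \<noteq> y \<Longrightarrow> \<phi> (x - y) \<noteq> 0"
    "\<And>S. S \<subseteq> Q \<Longrightarrow> transp_on S (\<lambda>x y. \<phi> (x - y) > 0) \<Longrightarrow> card S \<le> m'"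
    using assms(4) unfolding realizes_def by blast
  have odd: "\<phi> (y - x) = - \<phi> (x - y)" for x y
    using hom[of "-1" "x - y"] by simp
  have zero: "\<phi> 0 = 0"
    using hom[of 0 0] by simp
  \<comment> \<open>\<open>W\<close> omits pairs of equal points, where \<open>\<phi>\<close>
    vanishes; \<open>U\<close> keeps them, since distinct copies are also compared at the same point
    of \<open>Q\<close>.\<close>
  define W where "W = (\<lambda>(x, y). x - y) ` {p \<in> B \<times> B. fst p \<noteq> snd p}"
  define U where "U = (\<lambda>(x, y). x - y) ` (Q \<times> Q)"
  have "finite W" "finite U" "\<And>w. w \<in> W \<Longrightarrow> \<phi> w \<noteq> 0"
    using B Q by (auto simp: W_def U_def)
  then obtain e where "e > 0" and e: "\<And>w u. w \<in> W \<Longrightarrow> u \<in> U \<Longrightarrow> \<phi> w * \<phi> (w + e *\<^sub>R u) > 0"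
    using small_perturbation_same_sign[OF cont] by blast
  define f :: "'a \<times> 'a \<Rightarrow> 'a" where "f = (\<lambda>(b, q). b + e *\<^sub>R q)"
  have outer: "\<phi> (b - b') * \<phi> (f (b, q) - f (b', q')) > 0"
    if "b \<in> B" "b' \<in> B" "b \<noteq> b'" "q \<in> Q" "q' \<in> Q" for b b' q q'
  proof -
    have "b - b' \<in> W" "q - q' \<in> U"
      using that by (auto simp: W_def U_def image_iff intro!: bexI[of _ "(b, b')"] bexI[of _ "(q, q')"])
    from e[OF this] show ?thesis
      by (simp add: f_def algebra_simps)
  qed
  have inner: "\<phi> (f (b, q) - f (b, q')) = e ^ 3 * \<phi> (q - q')" for b q q'
    using hom[of e "q - q'"] by (simp add: f_def algebra_simps)
  have gen: "\<phi> (f s - f s') \<noteq> 0" if "s \<in> B \<times> Q" "s' \<in> B \<times> Q" "s \<noteq> s'" for s s'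
  proof (cases "fst s = fst s'")
    case True
    with that Q(3)[of "snd s" "snd s'"] inner[of "fst s" "snd s" "snd s'"] \<open>e > 0\<close> show ?thesis
      by (auto simp: prod_eq_iff)
  next
    case False
    with that outer[of "fst s" "fst s'" "snd s" "snd s'"] show ?thesis
      by (auto simp: mem_Times_iff)
  qed
  \<comment> \<open>Two distinct indices with the same image would have difference 0, where
    \<open>\<phi>\<close> vanishes, against \<open>gen\<close>.\<close>
  have inj: "inj_on f (B \<times> Q)"
    using gen zero by (metis diff_self inj_onI)
  show ?thesis
    unfolding realizes_def
  proof (intro exI[of _ "f ` (B \<times> Q)"] conjI ballI allI impI)
    show "finite (f ` (B \<times> Q))" using B Q by simp
    show "card (f ` (B \<times> Q)) = n * n'"
      using inj B Q by (simp add: card_image)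
    show "\<phi> (x - y) \<noteq> 0" if "x \<in> f ` (B \<times> Q)" "y \<in> f ` (B \<times> Q)" "x \<noteq> y" for x y
      using gen that by auto
  next
    fix S assume S: "S \<subseteq> f ` (B \<times> Q)" and tr: "transp_on S (\<lambda>x y. \<phi> (x - y) > 0)"
    define P where "P = {s \<in> B \<times> Q. f s \<in> S}"
    have P: "P \<subseteq> B \<times> Q" "finite P" and SP: "S = f ` P"
      using B Q S by (auto simp: P_def)
    \<comment> \<open>\<open>F b\<close> is the part of \<open>S\<close> lying in the copy at
      \<open>b\<close>, read off in \<open>Q\<close>.\<close>
    define F where "F = (\<lambda>b. {q. (b, q) \<in> P})"
    have fibre: "card (F b) \<le> m'" for b
    proof (rule Q(4))
      show "F b \<subseteq> Q" using P by (auto simp: F_def)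
      show "transp_on (F b) (\<lambda>x y. 0 < \<phi> (x - y))"
      proof (rule transp_onI)
        fix x y z assume *: "x \<in> F b" "y \<in> F b" "z \<in> F b" "0 < \<phi> (x - y)" "0 < \<phi> (y - z)"
        then have "f (b, x) \<in> S" "f (b, y) \<in> S" "f (b, z) \<in> S"
          by (simp_all add: F_def P_def)
        moreover have "0 < \<phi> (f (b, x) - f (b, y))" "0 < \<phi> (f (b, y) - f (b, z))"
          using * inner \<open>e > 0\<close> by simp_all
        ultimately have "0 < \<phi> (f (b, x) - f (b, z))"
          by (rule transp_onD[OF tr])
        then show "0 < \<phi> (x - z)"
          using inner \<open>e > 0\<close> by (simp add: zero_less_mult_iff)
      qed
    qed
    have base: "card (fst ` P) \<le> m"
    proof (rule B(4))
      show "fst ` P \<subseteq> B" using P by auto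
      show "transp_on (fst ` P) (\<lambda>x y. 0 < \<phi> (x - y))"
      proof (rule transp_onI)
        fix x y z assume *: "x \<in> fst ` P" "y \<in> fst ` P" "z \<in> fst ` P" "0 < \<phi> (x - y)" "0 < \<phi> (y - z)"
        then obtain q r s where qrs: "(x, q) \<in> P" "(y, r) \<in> P" "(z, s) \<in> P"
          by auto
        then have in_BQ: "x \<in> B" "y \<in> B" "z \<in> B" "q \<in> Q" "r \<in> Q" "s \<in> Q"
          using P by auto
        \<comment> \<open>If \<open>z\<close> were \<open>x\<close>, then
          \<open>\<phi> (x - y)\<close> and \<open>\<phi> (y - x)\<close> would both be positive,
          against oddness.\<close>
        have ne: "x \<noteq> y" "y \<noteq> z" "x \<noteq> z"
          using * zero odd[of x y] by auto
        have "f (x, q) \<in> S" "f (y, r) \<in> S" "f (z, s) \<in> S"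
          using qrs by (simp_all add: P_def)
        moreover have "0 < \<phi> (f (x, q) - f (y, r))" "0 < \<phi> (f (y, r) - f (z, s))"
          using outer[of x y q r] outer[of y z r s] ne in_BQ * by (auto simp: zero_less_mult_iff)
        ultimately have "0 < \<phi> (f (x, q) - f (z, s))"
          by (rule transp_onD[OF tr])
        then show "0 < \<phi> (x - z)"
          using outer[of x z q s] ne in_BQ by (auto simp: zero_less_mult_iff)
      qed
    qed
    have finF: "finite (F b)" for b
    proof (rule finite_subset)
      show "F b \<subseteq> snd ` P" by (force simp: F_def)
    qed (use P in simp)
    have "P = (SIGMA b:fst ` P. F b)"
      by (force simp: F_def)
    then have "card P = (\<Sum>b\<in>fst ` P. card (F b))"
      using P(2) finF card_SigmaI[of "fst ` P" F] by simp
    also have "\<dots> \<le> card (fst ` P) * m'"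
      using sum_bounded_above[of "fst ` P" "\<lambda>b. card (F b)" m'] fibre by simp
    also have "\<dots> \<le> m * m'"
      using base by simp
    finally show "card S \<le> m * m'"
      using card_image_le[OF P(2), of f] by (simp add: SP)
  qed
qed

section \<open>The crossing form and the Paley tournament on seven vertices\<close>

text \<open>The entries are differences of the parameters of two lines. The projections meet at t =
  -b/a, where the heights differ by c t + d = (d a - c b)/a; multiplying by the square of a keeps
  the sign and gives a cubic form.\<close>

definition orient :: "real \<times> real \<times> real \<times> real \<Rightarrow> real" where
  "orient = (\<lambda>(a, b, c, d). (d * a - c * b) * a)"

lemma continuous_orient: "continuous_on UNIV orient"
  unfolding orient_def case_prod_unfold by (intro continuous_intros)

lemma orient_scaleR: "orient (r *\<^sub>R x) = r ^ 3 * orient x"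
  by (cases x) (simp add: orient_def algebra_simps power3_eq_cube)

lemma orient_minus_commute: "orient (y - x) = - orient (x - y)"
  using orient_scaleR[of "-1" "x - y"] by simp

text \<open>The seven points were found by a computer search.\<close>

lemma realizes_7_3: "realizes orient 7 3"
proof -
  \<comment> \<open>The first coordinates run from -3 to 3, so the slopes of the projected lines are
    distinct.\<close>
  define x0 x1 x2 x3 x4 x5 x6 :: "real \<times> real \<times> real \<times> real" where
    x: "x0 = (-3, -1, -2, 0)" "x1 = (-2, -2, 2, 1)" "x2 = (-1, 3, -3, 0)" "x3 = (0, -3, 0, -1)"
       "x4 = (1, 1, -3, -2)" "x5 = (2, 3, 2, 3)" "x6 = (3, 0, -1, -1)"
  let ?R = "\<lambda>x y. orient (x - y) > 0"
  let ?B = "{x0, x1, x2, x3, x4, x5, x6}"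
  have dist: "distinct [x0, x1, x2, x3, x4, x5, x6]"
    by (simp add: x)
  have gen: "\<forall>x\<in>?B. \<forall>y\<in>?B. x \<noteq> y \<longrightarrow> orient (x - y) \<noteq> 0"
    by (simp add: x orient_def)
  have arcs: "?R x0 x4" "?R x0 x5" "?R x0 x6" "?R x1 x0" "?R x1 x3" "?R x1 x6" "?R x2 x0"
    "?R x2 x1" "?R x2 x4" "?R x3 x0" "?R x3 x2" "?R x3 x5" "?R x4 x1" "?R x4 x3"
    "?R x4 x5" "?R x5 x1" "?R x5 x2" "?R x5 x6" "?R x6 x2" "?R x6 x3" "?R x6 x4"
    by (simp_all add: x orient_def)
  have cyc: False if "transp_on S ?R" "u \<in> S" "v \<in> S" "w \<in> S" "?R u v" "?R v w" "?R w u" for S u v w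
    using transp_onD[OF that(1,2,3,4)] that orient_minus_commute[of u w] by simp
  have "card S \<le> 3" if S: "S \<subseteq> ?B" and tr: "transp_on S ?R" for S
  proof -
    \<comment> \<open>A sum of seven indicators can be evaluated by simplification in each of the
      128 cases below.\<close>
    have "card S = (\<Sum>x\<in>?B. if x \<in> S then 1 else 0)"
      using S by (subst sum.inter_restrict[symmetric]) (simp_all add: Int_absorb1)
    also have "\<dots> = (\<Sum>x\<leftarrow>[x0, x1, x2, x3, x4, x5, x6]. if x \<in> S then 1 else 0)"
      using dist by (subst sum_list_distinct_conv_sum_set) simp_all
    finally have card: "card S = \<dots>" .
    \<comment> \<open>These are all 14 cyclic triangles of the tournament. Each out-neighbourhood is
      one of them, so any four vertices contain a cyclic triangle: otherwise they would be
      transitive, and so would the three vertices beaten by their source.\<close>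
    have "\<not> (x0 \<in> S \<and> x4 \<in> S \<and> x1 \<in> S)" "\<not> (x0 \<in> S \<and> x4 \<in> S \<and> x3 \<in> S)"
      "\<not> (x0 \<in> S \<and> x5 \<in> S \<and> x1 \<in> S)" "\<not> (x0 \<in> S \<and> x5 \<in> S \<and> x2 \<in> S)"
      "\<not> (x0 \<in> S \<and> x6 \<in> S \<and> x2 \<in> S)" "\<not> (x0 \<in> S \<and> x6 \<in> S \<and> x3 \<in> S)"
      "\<not> (x1 \<in> S \<and> x3 \<in> S \<and> x2 \<in> S)" "\<not> (x1 \<in> S \<and> x3 \<in> S \<and> x5 \<in> S)"
      "\<not> (x1 \<in> S \<and> x6 \<in> S \<and> x2 \<in> S)" "\<not> (x1 \<in> S \<and> x6 \<in> S \<and> x4 \<in> S)"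
      "\<not> (x2 \<in> S \<and> x4 \<in> S \<and> x3 \<in> S)" "\<not> (x2 \<in> S \<and> x4 \<in> S \<and> x5 \<in> S)"
      "\<not> (x3 \<in> S \<and> x5 \<in> S \<and> x6 \<in> S)" "\<not> (x4 \<in> S \<and> x5 \<in> S \<and> x6 \<in> S)"
      using arcs cyc[OF tr] by blast+
    then show ?thesis
      unfolding card
      by (cases "x0 \<in> S"; cases "x1 \<in> S"; cases "x2 \<in> S"; cases "x3 \<in> S"; cases "x4 \<in> S";
          cases "x5 \<in> S"; cases "x6 \<in> S"; simp)
  qed
  with gen show ?thesis
    unfolding realizes_def using distinct_card[OF dist]
    by (intro exI[of _ ?B]) (auto simp del: insert_iff)
qed

lemma realizes_powers: "realizes orient (7 ^ k) (3 ^ k)"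
proof (induction k)
  case 0
  then show ?case using realizes_1 by simp
next
  case (Suc k)
  then show ?case
    using realizes_mult[OF continuous_orient orient_scaleR realizes_7_3 Suc] by simp
qed

section \<open>Lines, parallelism and singleton stacked sets\<close>

definition line :: "'a::real_vector \<Rightarrow> 'a \<Rightarrow> 'a set" where
  "line p u = range (\<lambda>t. p + t *\<^sub>R u)"

lemma line_eq_affine_hull: "line p u = affine hull {p, p + u}"
  by (simp add: line_def affine_hull_2_alt)

lemma is_line_line: "u \<noteq> 0 \<Longrightarrow> is_line (line p u)"
  by (simp add: is_line_def line_eq_affine_hull aff_dim_affine_hull aff_dim_2)

lemma span_eq_line: "span {v} = line 0 v"
  by (simp add: line_def span_singleton)

text \<open>Translations preserve differences, and \<open>w\<close> is a difference of two points of
  \<open>line q w\<close>. Parallelism can then be refuted by comparing coordinates of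
  directions.\<close>

lemma affine_parallel_line_imp_collinear:
  assumes "affine_parallel (line p u) (line q w)"
  obtains s where "w = s *\<^sub>R u"
proof -
  obtain a where a: "line q w = (\<lambda>x. a + x) ` line p u"
    using assms by (auto simp: affine_parallel_def)
  have "q + 0 *\<^sub>R w \<in> line q w" "q + 1 *\<^sub>R w \<in> line q w"
    unfolding line_def by blast+
  then obtain t t' where "q + 0 *\<^sub>R w = a + (p + t *\<^sub>R u)" "q + 1 *\<^sub>R w = a + (p + t' *\<^sub>R u)"
    unfolding a unfolding line_def image_iff by blast
  then have "q = a + (p + t *\<^sub>R u)" "q + w = a + (p + t' *\<^sub>R u)"
    by simp_all
  then have "w = (a + (p + t' *\<^sub>R u)) - (a + (p + t *\<^sub>R u))"
    by (metis add_diff_cancel_left')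
  then have "w = (t' - t) *\<^sub>R u"
    by (simp add: algebra_simps)
  then show ?thesis using that by blast
qed

text \<open>A one-dimensional affine set is the affine hull of any two of its points, and here two
  of them differ by a nonzero multiple of \<open>v\<close>.\<close>

lemma line_containing_direction:
  assumes "is_line l" "p + z *\<^sub>R v \<in> l" "p + z' *\<^sub>R v \<in> l" "z \<noteq> z'" "v \<noteq> 0"
  shows "affine_parallel l (span {v})"
proof -
  let ?x = "p + z *\<^sub>R v" and ?u = "(z' - z) *\<^sub>R v"
  have "?x \<noteq> ?x + ?u" and eq: "?x + ?u = p + z' *\<^sub>R v"
    using assms by (auto simp: algebra_simps)
  then have "aff_dim (line ?x ?u) = aff_dim l"
    using assms unfolding line_eq_affine_hull aff_dim_affine_hull by (simp add: is_line_def aff_dim_2)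
  moreover have "line ?x ?u \<subseteq> l"
    unfolding line_eq_affine_hull eq using assms by (intro hull_minimal) (auto simp: is_line_def)
  ultimately have l: "line ?x ?u = l"
    using assms by (intro affine_dim_equal) (auto simp: is_line_def line_eq_affine_hull)
  have "(\<lambda>y. - ?x + y) ` l = line 0 ?u"
    unfolding l[symmetric] line_def by (auto simp: image_image)
  also have "\<dots> = span {v}"
    unfolding span_eq_line[symmetric]
    using assms by (intro span_image_scale[where c = "\<lambda>_. z' - z" and S = "{v}", simplified]) auto
  finally show ?thesis
    unfolding affine_parallel_def by blast
qed

text \<open>Only irreflexivity is at stake: a line crossing over itself would contain two points
  differing by a multiple of \<open>v\<close>, hence be parallel to \<open>v\<close>.\<close>

lemma stacked_singleton:
  assumes "line_config v L" "l \<in> L"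
  shows "stacked v {l}"
proof -
  have "\<not> crosses_over v l l"
    using assms line_containing_direction[of l] unfolding line_config_def crosses_over_def by fastforce
  then show ?thesis
    by (auto simp: stacked_def strict_linear_order_on_def trans_def irrefl_def total_on_def)
qed

text \<open>Supplies the nonemptiness without which the supremum could not be bounded. Singletons
  suffice, with constant 1.\<close>

lemma zero_in_stacked_exponents: "0 \<in> stacked_exponents"
proof -
  have "\<exists>S\<subseteq>L. stacked v S \<and> real (card S) \<ge> 1 * real n powr 0"
    if n: "n \<ge> 1" and L: "line_config v L \<and> card L = n" for n :: nat and v L
  proof -
    obtain l where "l \<in> L" using n L by fastforce
    then show ?thesis
      using stacked_singleton[of v L l] L by (intro exI[of _ "{l}"]) auto
  qed
  then show ?thesis
    unfolding stacked_exponents_def mem_Collect_eq using zero_less_one by blast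
qed

section \<open>Graph lines and their crossings\<close>

definition graph_line :: "real \<times> real \<times> real \<times> real \<Rightarrow> (real^3) set" where
  "graph_line = (\<lambda>(a, b, c, d). line (vector [0, b, d]) (vector [1, a, c]))"

abbreviation vertical :: "real^3" where
  "vertical \<equiv> vector [0, 0, 1]"

lemma mem_graph_line_iff: "x \<in> graph_line (a, b, c, d) \<longleftrightarrow> x $ 2 = a * x $ 1 + b \<and> x $ 3 = c * x $ 1 + d"
  by (auto simp: graph_line_def line_def image_iff vec_eq_iff forall_3 algebra_simps intro!: exI[of _ "x $ 1"])

lemma proj_vertical: "proj_along vertical x = vector [x $ 1, x $ 2, 0]"
  by (simp add: proj_along_def vec_eq_iff forall_3 inner_vec_def sum_3)

lemma proj_graph_line:
  "proj_along vertical ` graph_line (a, b, c, d) = line (vector [0, b, 0]) (vector [1, a, 0])"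
  by (auto simp: graph_line_def line_def image_image proj_vertical vec_eq_iff forall_3 intro!: image_cong)

lemma vector_3_scaleR: "vector [x, y, z] = s *\<^sub>R (vector [x', y', z'] :: real^3) \<longleftrightarrow>
    x = s * x' \<and> y = s * y' \<and> z = s * z'"
  by (simp add: vec_eq_iff forall_3)

lemma crosses_over_graph_line_iff:
  assumes "fst x \<noteq> fst y"
  shows "crosses_over vertical (graph_line x) (graph_line y) \<longleftrightarrow> orient (x - y) > 0"
proof -
  obtain a b c d a' b' c' d' where xy: "x = (a, b, c, d)" "y = (a', b', c', d')"
    by (cases x, cases y) auto
  have ne: "a - a' \<noteq> 0" using assms by (simp add: xy)
  define t where "t = (b' - b) / (a - a')"
  have t: "(a - a') * t = b' - b"
    using ne by (simp add: t_def)
  then have abt: "a * t + b = a' * t + b'"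
    by (simp add: algebra_simps)
  have key: "orient (x - y) = (a - a')\<^sup>2 * ((c * t + d) - (c' * t + d'))"
  proof -
    \<comment> \<open>The product \<open>(a - a') * t\<close> is kept together so that the fact
      \<open>t\<close> can replace it by \<open>b' - b\<close>.\<close>
    have "(a - a')\<^sup>2 * ((c * t + d) - (c' * t + d')) =
        ((c - c') * ((a - a') * t) + (d - d') * (a - a')) * (a - a')"
      by (simp add: algebra_simps power2_eq_square)
    then show ?thesis
      unfolding t by (simp add: xy orient_def algebra_simps)
  qed
  have "crosses_over vertical (graph_line x) (graph_line y) \<longleftrightarrow> c * t + d > c' * t + d'"
  proof
    assume "crosses_over vertical (graph_line x) (graph_line y)"
    then obtain p z z' where p: "p \<in> range (proj_along vertical)"
      and z: "p + z *\<^sub>R vertical \<in> graph_line x" "p + z' *\<^sub>R vertical \<in> graph_line y" "z > z'"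
      unfolding crosses_over_def by blast
    \<comment> \<open>With \<open>p\<close> in the horizontal plane, \<open>z\<close> and
      \<open>z'\<close> are the third coordinates of the two points.\<close>
    have p3: "p $ 3 = 0" using p by (auto simp: proj_vertical)
    have eqs: "p $ 2 = a * p $ 1 + b" "p $ 2 = a' * p $ 1 + b'" "z = c * p $ 1 + d" "z' = c' * p $ 1 + d'"
      using z p3 by (auto simp: xy mem_graph_line_iff)
    then have "(a - a') * p $ 1 = b' - b" by (simp add: algebra_simps)
    then have "p $ 1 = t" using ne by (simp add: t_def field_simps)
    with eqs z show "c * t + d > c' * t + d'" by simp
  next
    assume gt: "c * t + d > c' * t + d'"
    let ?p = "vector [t, a * t + b, 0] :: real^3"
    have on: "?p + (c * t + d) *\<^sub>R vertical \<in> graph_line x" "?p + (c' * t + d') *\<^sub>R vertical \<in> graph_line y"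
      using abt by (auto simp: xy mem_graph_line_iff)
    have "?p = proj_along vertical (?p + z *\<^sub>R vertical)" for z
      by (simp add: proj_vertical vec_eq_iff forall_3)
    then show "crosses_over vertical (graph_line x) (graph_line y)"
      unfolding crosses_over_def using on gt by blast
  qed
  also have "\<dots> \<longleftrightarrow> orient (x - y) > 0"
    using ne by (simp add: key zero_less_mult_iff)
  finally show ?thesis .
qed

lemma orient_nonzero_imp_fst_neq: "orient (x - y) \<noteq> 0 \<Longrightarrow> fst x \<noteq> fst y"
  by (cases x; cases y) (auto simp: orient_def)

text \<open>A common point makes the heights agree at the crossing, so \<open>orient\<close>
  vanishes. Directions have first coordinate 1, so parallel lines would have equal slopes
  \<open>a\<close> and \<open>a'\<close>, also after projection.\<close>

lemma skew_graph_line: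
  assumes "orient (x - y) \<noteq> 0"
  shows "skew (graph_line x) (graph_line y)"
    and "\<not> affine_parallel (proj_along vertical ` graph_line x) (proj_along vertical ` graph_line y)"
proof -
  obtain a b c d a' b' c' d' where xy: "x = (a, b, c, d)" "y = (a', b', c', d')"
    by (cases x, cases y) auto
  have ne: "a \<noteq> a'" using orient_nonzero_imp_fst_neq[OF assms] by (simp add: xy)
  have "graph_line x \<inter> graph_line y = {}"
  proof (rule ccontr)
    assume "graph_line x \<inter> graph_line y \<noteq> {}"
    then obtain p where "p \<in> graph_line x" "p \<in> graph_line y"
      by blast
    then have "p $ 2 = a * p $ 1 + b" "p $ 2 = a' * p $ 1 + b'"
        "p $ 3 = c * p $ 1 + d" "p $ 3 = c' * p $ 1 + d'"
      by (simp_all add: xy mem_graph_line_iff)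
    then have "b - b' = - ((a - a') * p $ 1)" "d - d' = - ((c - c') * p $ 1)"
      by (simp_all add: algebra_simps)
    then have "orient (x - y) = 0"
      by (simp add: xy orient_def)
    with assms show False by simp
  qed
  moreover have "\<not> affine_parallel (graph_line x) (graph_line y)"
    using ne by (auto simp: xy graph_line_def vector_3_scaleR elim!: affine_parallel_line_imp_collinear)
  ultimately show "skew (graph_line x) (graph_line y)"
    by (simp add: skew_def)
  show "\<not> affine_parallel (proj_along vertical ` graph_line x) (proj_along vertical ` graph_line y)"
    using ne by (auto simp: xy proj_graph_line vector_3_scaleR elim!: affine_parallel_line_imp_collinear)
qed

lemma graph_line_config:
  assumes "finite Q" "\<And>x y. x \<in> Q \<Longrightarrow> y \<in> Q \<Longrightarrow> x \<noteq> y \<Longrightarrow> orient (x - y) \<noteq> 0"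
  shows "line_config vertical (graph_line ` Q)" and "inj_on graph_line Q"
proof -
  have "vertical \<noteq> 0"
    by (simp add: vec_eq_iff forall_3)
  moreover have "is_line (graph_line x)" for x
    by (cases x) (auto simp: graph_line_def vec_eq_iff forall_3 intro!: is_line_line)
  moreover have "\<not> affine_parallel (graph_line x) (span {vertical})" for x
    by (cases x) (auto simp: graph_line_def span_eq_line vector_3_scaleR elim!: affine_parallel_line_imp_collinear)
  ultimately show "line_config vertical (graph_line ` Q)"
    unfolding line_config_def using assms skew_graph_line by fastforce
  \<comment> \<open>Distinct points give disjoint lines, and a nonempty line is not disjoint from
    itself; this yields injectivity.\<close>
  have "graph_line x \<noteq> {}" for x
    by (cases x) (simp add: graph_line_def line_def)
  then show "inj_on graph_line Q"
    using assms skew_graph_line(1) unfolding skew_def by (metis inf.idem inj_onI)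
qed

lemma stacked_graph_lines_imp_transp_on:
  assumes "\<And>x y. x \<in> S \<Longrightarrow> y \<in> S \<Longrightarrow> x \<noteq> y \<Longrightarrow> orient (x - y) \<noteq> 0"
    and "stacked vertical (graph_line ` S)"
  shows "transp_on S (\<lambda>x y. orient (x - y) > 0)"
proof (rule transp_onI)
  fix x y z assume S: "x \<in> S" "y \<in> S" "z \<in> S" and over: "0 < orient (x - y)" "0 < orient (y - z)"
  \<comment> \<open>Transitivity alone could return to the starting line; oddness excludes
    \<open>z = x\<close>, so the crossing criterion applies to this pair too.\<close>
  have "x \<noteq> z"
    using over orient_minus_commute[of x y] by auto
  then have *: "fst x \<noteq> fst y" "fst y \<noteq> fst z" "fst x \<noteq> fst z"
    using S over assms(1)[of x z] by (auto intro!: orient_nonzero_imp_fst_neq simp del: split_paired_All)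
  have "crosses_over vertical (graph_line x) (graph_line y)" "crosses_over vertical (graph_line y) (graph_line z)"
    using over * by (simp_all add: crosses_over_graph_line_iff)
  moreover have "trans {(l, l'). l \<in> graph_line ` S \<and> l' \<in> graph_line ` S \<and> crosses_over vertical l l'}"
    using assms(2) by (simp add: stacked_def strict_linear_order_on_def)
  ultimately have "crosses_over vertical (graph_line x) (graph_line z)"
    using S by (auto dest: transD[of _ "graph_line x" "graph_line y" "graph_line z"])
  then show "0 < orient (x - z)"
    using * by (simp add: crosses_over_graph_line_iff)
qed

lemma exists_config_with_small_stacked_subsets:
  "\<exists>L. line_config vertical L \<and> card L = 7 ^ k \<and> (\<forall>S\<subseteq>L. stacked vertical S \<longrightarrow> card S \<le> 3 ^ k)"
proof -
  obtain Q where Q: "finite Q" "card Q = 7 ^ k"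
    and gen: "\<And>x y. x \<in> Q \<Longrightarrow> y \<in> Q \<Longrightarrow> x \<noteq> y \<Longrightarrow> orient (x - y) \<noteq> 0"
    and small: "\<And>S. S \<subseteq> Q \<Longrightarrow> transp_on S (\<lambda>x y. orient (x - y) > 0) \<Longrightarrow> card S \<le> 3 ^ k"
    using realizes_powers[of k] unfolding realizes_def by blast
  note config = graph_line_config[OF Q(1) gen]
  have "card S \<le> 3 ^ k" if S: "S \<subseteq> graph_line ` Q" "stacked vertical S" for S
  proof -
    obtain T where T: "T \<subseteq> Q" "S = graph_line ` T"
      using S(1) by (auto simp: subset_image_iff)
    then have "transp_on T (\<lambda>x y. orient (x - y) > 0)"
      using S(2) gen subsetD[OF T(1)] by (intro stacked_graph_lines_imp_transp_on) blast+
    then have "card T \<le> 3 ^ k"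
      using small T by blast
    then show ?thesis
      using T Q(1) card_image_le[of T graph_line] finite_subset by fastforce
  qed
  then show ?thesis
    using config Q by (intro exI[of _ "graph_line ` Q"]) (auto simp: card_image)
qed

section \<open>The bound on the exponent\<close>

text \<open>If \<open>x\<close> exceeded \<open>y\<close>, the powers of \<open>x / y\<close> would
  outgrow \<open>1 / c\<close>. This removes the unknown constant from the estimates for all
  \<open>k\<close>.\<close>

lemma bounded_geometric_imp_le:
  fixes c x y :: real
  assumes "c > 0" "y > 0" "\<And>k. c * x ^ k \<le> y ^ k"
  shows "x \<le> y"
proof (rule ccontr)
  assume "\<not> x \<le> y"
  then have "1 < x / y" using assms by simp
  then obtain k where "1 / c < (x / y) ^ k" using real_arch_pow by blast
  then have "y ^ k < c * x ^ k"
    using assms by (simp add: field_simps)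
  with assms(3)[of k] show False by simp
qed

theorem proposition3:
  shows "eps_LINE \<le> ln 3 / ln 7"
  unfolding eps_LINE_def
proof (rule cSup_least)
  show "stacked_exponents \<noteq> {}"
    using zero_in_stacked_exponents by blast
next
  fix \<epsilon> assume "\<epsilon> \<in> stacked_exponents"
  then obtain c where "c > 0" and c: "\<And>n v L. n \<ge> 1 \<Longrightarrow> line_config v L \<Longrightarrow> card L = n \<Longrightarrow>
      \<exists>S\<subseteq>L. stacked v S \<and> real (card S) \<ge> c * real n powr \<epsilon>"
    unfolding stacked_exponents_def by blast
  \<comment> \<open>The exponent's guarantee is tested at \<open>n = 7 ^ k\<close>, where every
    stacked subset has at most \<open>3 ^ k\<close> lines.\<close>
  have "c * (7 powr \<epsilon>) ^ k \<le> 3 ^ k" for k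
  proof -
    obtain L where L: "line_config vertical L" "card L = 7 ^ k"
      and small: "\<And>S. S \<subseteq> L \<Longrightarrow> stacked vertical S \<Longrightarrow> card S \<le> 3 ^ k"
      using exists_config_with_small_stacked_subsets[of k] by blast
    obtain S where S: "S \<subseteq> L" "stacked vertical S" "real (card S) \<ge> c * real (7 ^ k) powr \<epsilon>"
      using c[OF _ L] by auto
    have "real (7 ^ k) powr \<epsilon> = (7 powr \<epsilon>) ^ k"
      by (simp add: powr_realpow[symmetric] powr_powr mult.commute powr_power)
    moreover have "real (card S) \<le> 3 ^ k"
      using small[OF S(1,2)] of_nat_mono[of "card S" "3 ^ k"] by simp
    ultimately show ?thesis
      using S(3) by (metis order_trans)
  qed
  then have "7 powr \<epsilon> \<le> 3"
    using \<open>c > 0\<close> by (rule bounded_geometric_imp_le[rotated 2]) simp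
  then have "ln (7 powr \<epsilon>) \<le> ln 3"
    by (subst ln_le_cancel_iff) auto
  then show "\<epsilon> \<le> ln 3 / ln 7"
    by (simp add: ln_powr field_simps)
qed

end
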